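(* Let $d\geq 1$ and let $A\subseteq\mathbb{Z}^d$ be finite. Then for every integer $t\geq 1$ there exist $h^{\mathrm{Kh}}_t(A)\in\mathbb{Z}_{\geq 0}$ and a polynomial $p_{A,t}(x)\in\mathbb{Q}[x]$ of degree $\leq d$ such that for every integer $h\geq h^{\mathrm{Kh}}_t(A)$, $$|(hA)^{(t)}|=p_{A,t}(h).$$
   Context: For a finite set $A\subseteq\mathbb{Z}^d$ and integers $h,t\ge 1$, $r_{A,h}(p)$ is the number of $(k_a)_{a\in A}\in\mathbb{Z}_{\geq 0}^{A}$ with $\sum_{a\in A}k_a a=p$ and $\sum_{a\in A}k_a=h$, and $(hA)^{(t)}:=\{p\in\mathbb{Z}^d : r_{A,h}(p)\geq t\}$ is the set of points with at least $t$ representations as an (unordered) sum of $h$ elements of $A$. *)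

theory Defs
  imports
    "HOL-Analysis.Finite_Cartesian_Product"
    "HOL-Computational_Algebra.Polynomial"
    "HOL-Library.FuncSet"
begin

text \<open>
  The lattice \<open>\<int>\<^sup>d\<close> is \<open>int ^ 'd\<close> with \<open>d = CARD('d) \<ge> 1\<close>.  A family of
  nonnegative integers indexed by \<open>A\<close> is an element of \<open>A \<rightarrow>\<^sub>E UNIV\<close>; extensionality
  makes families that agree on \<open>A\<close> equal, so that \<open>card\<close> counts them correctly.
\<close>

definition representations ::
    "(int ^ 'd) set \<Rightarrow> nat \<Rightarrow> int ^ 'd \<Rightarrow> (int ^ 'd \<Rightarrow> nat) set" where
  "representations A h p =
     {k \<in> A \<rightarrow>\<^sub>E UNIV. (\<Sum>a\<in>A. int (k a) *s a) = p \<and> (\<Sum>a\<in>A. k a) = h}"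

text \<open>
  For finite \<open>A\<close> the set of representations is finite, so \<open>card\<close> is the true number.
\<close>

definition rep_count :: "(int ^ 'd) set \<Rightarrow> nat \<Rightarrow> int ^ 'd \<Rightarrow> nat" where
  "rep_count A h p = card (representations A h p)"

definition rep_sumset :: "nat \<Rightarrow> (int ^ 'd) set \<Rightarrow> nat \<Rightarrow> (int ^ 'd) set" where
  "rep_sumset h A t = {p. rep_count A h p \<ge> t}"

end

theory Submission
  imports Defs
    "HOL-Computational_Algebra.Primes"
begin

text \<open>
  The points with at least \<open>t\<close> representations are counted through the representations
  themselves, that is, through vectors \<open>k\<close> in \<open>\<nat>\<^sup>A\<close>.  Two such vectors lie in the same fibre if
  they have the same coordinate sum and represent the same point.  Order \<open>\<nat>\<^sup>A\<close> linearly in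
  a way that is invariant under translation, and let the rank of \<open>k\<close> be the number of smaller
  vectors in its fibre.  A fibre with \<open>r\<close> elements contains exactly one vector of each rank
  \<open>0, \<dots>, r - 1\<close>, so a point has more than \<open>s\<close> representations iff it is represented by a
  vector of rank \<open>s\<close>, which is then unique.  With \<open>t = s + 1\<close>, the number of points sought is
  therefore the number of vectors of coordinate sum \<open>h\<close> and rank at least \<open>s\<close>, minus the
  number of those of rank at least \<open>s + 1\<close>.

  Translating a vector carries the smaller vectors of its fibre to smaller vectors of the new
  fibre, so the rank can only grow and each set \<open>{k. rank k \<ge> s}\<close> is closed upwards
  (\<open>eventually_polynomial_rep_sumset\<close>).  An up-closed subset of \<open>\<nat>\<^sup>A\<close> is the set of exponents
  of a monomial ideal, and the number of its elements of coordinate sum \<open>h\<close> is a Hilbert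
  function, hence a polynomial in \<open>h\<close> for large \<open>h\<close>
  (\<open>eventually_polynomial_up_closed\<close>).  This follows by induction on \<open>A\<close>: the slices at
  a fixed value of one coordinate form an increasing chain of up-closed sets, which by
  Dickson's lemma is eventually constant (\<open>up_closed_chain_stabilises\<close>).

  The degree of these Hilbert polynomials is governed by the size of \<open>A\<close>, and the bound \<open>d\<close> for
  their difference comes from elsewhere: all sums of \<open>h\<close> elements of \<open>A\<close> lie in
  a cube of side \<open>O(h)\<close>, which has \<open>O(h\<^sup>d)\<close> points (\<open>card_rep_sumset_le\<close>), and a polynomial of
  larger degree outgrows this or becomes negative (\<open>degree_le_if_poly_bounded\<close>).
\<close>

section \<open>Eventually polynomial functions\<close>

definition eventually_polynomial :: "(nat \<Rightarrow> rat) \<Rightarrow> bool" where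
  "eventually_polynomial f \<longleftrightarrow>
     (\<exists>p. eventually (\<lambda>h. f h = poly p (of_nat h)) sequentially)"

lemma eventually_polynomial_poly: "eventually_polynomial (\<lambda>h. poly p (of_nat h))"
  unfolding eventually_polynomial_def by (intro exI[of _ p]) simp

lemma eventually_polynomial_const: "eventually_polynomial (\<lambda>h. c)"
  using eventually_polynomial_poly[of "[:c:]"] by simp

lemma eventually_polynomial_cong:
  assumes "eventually (\<lambda>h. f h = g h) sequentially" "eventually_polynomial g"
  shows "eventually_polynomial f"
proof -
  obtain p where p: "eventually (\<lambda>h. g h = poly p (of_nat h)) sequentially"
    using assms(2) unfolding eventually_polynomial_def by blast
  have "eventually (\<lambda>h. f h = poly p (of_nat h)) sequentially"
    using assms(1) p by eventually_elim simp
  then show ?thesis unfolding eventually_polynomial_def by blast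
qed

lemma eventually_polynomial_add:
  assumes "eventually_polynomial f" "eventually_polynomial g"
  shows "eventually_polynomial (\<lambda>h. f h + g h)"
proof -
  obtain p q where p: "eventually (\<lambda>h. f h = poly p (of_nat h)) sequentially"
    and q: "eventually (\<lambda>h. g h = poly q (of_nat h)) sequentially"
    using assms unfolding eventually_polynomial_def by blast
  have "eventually (\<lambda>h. f h + g h = poly (p + q) (of_nat h)) sequentially"
    using p q by eventually_elim simp
  then show ?thesis unfolding eventually_polynomial_def by blast
qed

lemma eventually_polynomial_cmult:
  assumes "eventually_polynomial f"
  shows "eventually_polynomial (\<lambda>h. c * f h)"
proof -
  obtain p where p: "eventually (\<lambda>h. f h = poly p (of_nat h)) sequentially"
    using assms unfolding eventually_polynomial_def by blast
  have "eventually (\<lambda>h. c * f h = poly (smult c p) (of_nat h)) sequentially"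
    using p by eventually_elim simp
  then show ?thesis unfolding eventually_polynomial_def by blast
qed

lemma eventually_polynomial_diff:
  assumes "eventually_polynomial f" "eventually_polynomial g"
  shows "eventually_polynomial (\<lambda>h. f h - g h)"
  using eventually_polynomial_add[OF assms(1) eventually_polynomial_cmult[OF assms(2), of "-1"]]
  by simp

lemma eventually_polynomial_sum:
  assumes "\<And>i. i \<in> I \<Longrightarrow> eventually_polynomial (f i)"
  shows "eventually_polynomial (\<lambda>h. \<Sum>i\<in>I. f i h)"
  using assms
  by (induction I rule: infinite_finite_induct)
     (auto intro: eventually_polynomial_const eventually_polynomial_add)

lemma eventually_polynomial_shift:
  assumes "eventually_polynomial f"
  shows "eventually_polynomial (\<lambda>h. f (h - j))"
proof -
  obtain p where p: "eventually (\<lambda>h. f h = poly p (of_nat h)) sequentially"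
    using assms unfolding eventually_polynomial_def by blast
  have "eventually (\<lambda>h. f (h - j) = poly p (of_nat (h - j))) sequentially"
    using p filterlim_minus_const_nat_at_top[of j] unfolding filterlim_iff by blast
  then have "eventually (\<lambda>h. f (h - j) = poly (pcompose p [:- of_nat j, 1:]) (of_nat h)) sequentially"
    using eventually_ge_at_top[of j]
    by eventually_elim (simp add: poly_pcompose of_nat_diff)
  then show ?thesis unfolding eventually_polynomial_def by blast
qed

text \<open>
  Pascal's recursion: telescoping \<open>(i + 1)\<^bsup>n+1\<^esup> - i\<^bsup>n+1\<^esup>\<close> over \<open>i < h\<close> expresses \<open>h\<^bsup>n+1\<^esup>\<close>
  through the power sums of exponent at most \<open>n\<close>, and the one of exponent \<open>n\<close> occurs
  with the nonzero coefficient \<open>n + 1\<close>.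
\<close>

lemma eventually_polynomial_power_sum:
  "eventually_polynomial (\<lambda>h. \<Sum>i<h. of_nat i ^ n)"
proof (induction n rule: less_induct)
  case (less n)
  define S where "S m h = (\<Sum>i<h. (of_nat i :: rat) ^ m)" for m h :: nat
  have telescope: "of_nat h ^ Suc n = (\<Sum>m<n. of_nat (Suc n choose m) * S m h) + of_nat (Suc n) * S n h"
    for h
  proof -
    have "(of_nat h :: rat) ^ Suc n = (\<Sum>i<h. of_nat (Suc i) ^ Suc n - of_nat i ^ Suc n)"
      using sum_lessThan_telescope[of "\<lambda>i. (of_nat i :: rat) ^ Suc n" h] by simp
    also have "\<dots> = (\<Sum>i<h. \<Sum>m\<le>n. of_nat (Suc n choose m) * of_nat i ^ m)"
    proof (rule sum.cong)
      fix i
      have "(of_nat (Suc i) :: rat) ^ Suc n = (\<Sum>m\<le>Suc n. of_nat (Suc n choose m) * of_nat i ^ m)"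
        using binomial_ring[of "of_nat i :: rat" 1 "Suc n"] by (simp add: add.commute)
      then show "(of_nat (Suc i) :: rat) ^ Suc n - of_nat i ^ Suc n
          = (\<Sum>m\<le>n. of_nat (Suc n choose m) * of_nat i ^ m)"
        by simp
    qed simp
    also have "\<dots> = (\<Sum>m\<le>n. of_nat (Suc n choose m) * S m h)"
      unfolding S_def sum_distrib_left by (rule sum.swap)
    also have "\<dots> = (\<Sum>m<n. of_nat (Suc n choose m) * S m h) + of_nat (Suc n) * S n h"
      by (simp add: lessThan_Suc_atMost[symmetric] del: of_nat_Suc)
    finally show ?thesis .
  qed
  have "S n = (\<lambda>h. 1 / of_nat (Suc n) *
      (poly (monom 1 (Suc n)) (of_nat h) - (\<Sum>m<n. of_nat (Suc n choose m) * S m h)))"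
    using telescope by (auto simp: fun_eq_iff poly_monom field_simps simp del: of_nat_Suc power_Suc)
  moreover have "eventually_polynomial \<dots>"
    by (intro eventually_polynomial_cmult eventually_polynomial_diff eventually_polynomial_sum
        eventually_polynomial_poly) (use less in \<open>simp add: S_def\<close>)
  ultimately have "eventually_polynomial (S n)" by (simp only:)
  then show ?case by (simp add: S_def[abs_def])
qed

text \<open>
  The finitely many values of \<open>f\<close> that differ from the polynomial change the partial sums by
  a constant.
\<close>

lemma eventually_polynomial_partial_sums:
  assumes "eventually_polynomial f"
  shows "eventually_polynomial (\<lambda>h. \<Sum>i\<le>h. f i)"
proof -
  obtain p n where p: "\<And>h. h \<ge> n \<Longrightarrow> f h = poly p (of_nat h)"
    using assms unfolding eventually_polynomial_def eventually_sequentially by blast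
  let ?c = "(\<Sum>i<n. f i) - (\<Sum>i<n. poly p (of_nat i))"
  have "(\<Sum>i<h. poly p (of_nat i)) = (\<Sum>m\<le>degree p. coeff p m * (\<Sum>i<h. of_nat i ^ m))" for h
    unfolding poly_altdef sum_distrib_left by (rule sum.swap)
  then have "eventually_polynomial (\<lambda>h. \<Sum>i<h. poly p (of_nat i))"
    by (simp add: eventually_polynomial_sum eventually_polynomial_cmult
        eventually_polynomial_power_sum)
  then have ep: "eventually_polynomial (\<lambda>h. (\<Sum>i<h. poly p (of_nat i)) + poly p (of_nat h) + ?c)"
    by (intro eventually_polynomial_add eventually_polynomial_poly eventually_polynomial_diff
        eventually_polynomial_const)
  have "(\<Sum>i\<le>h. f i) = (\<Sum>i<h. poly p (of_nat i)) + poly p (of_nat h) + ?c" if "h \<ge> n" for h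
  proof -
    have split: "{..h} = {..<n} \<union> {n..h}" using that by auto
    have "(\<Sum>i\<le>h. g i) = (\<Sum>i<n. g i) + (\<Sum>i=n..h. g i)" for g :: "nat \<Rightarrow> rat"
      unfolding split by (rule sum.union_disjoint) auto
    from this[of f] this[of "\<lambda>i. poly p (of_nat i)"] show ?thesis
      using p by (simp add: lessThan_Suc_atMost[symmetric])
  qed
  then have "eventually (\<lambda>h. (\<Sum>i\<le>h. f i) = (\<Sum>i<h. poly p (of_nat i)) + poly p (of_nat h) + ?c) sequentially"
    unfolding eventually_sequentially by blast
  then show ?thesis using ep by (rule eventually_polynomial_cong)
qed

lemma poly_map_of_rat: "poly (map_poly of_rat p) (of_rat x) = (of_rat (poly p x) :: real)"
  by (induction p) (auto simp: map_poly_pCons of_rat_add of_rat_mult)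

text \<open>
  If the degree exceeded \<open>d\<close>, then subtracting \<open>B x\<^sup>d\<close> would not change the leading
  coefficient, whose sign decides which of the two bounds is violated for large \<open>h\<close>.  The
  argument takes place over the reals, where a polynomial with positive leading coefficient
  is known to be eventually positive.
\<close>

lemma degree_le_if_poly_bounded:
  fixes p :: "rat poly"
  assumes bound: "eventually (\<lambda>h. 0 \<le> poly p (of_nat h) \<and> poly p (of_nat h) \<le> B * of_nat h ^ d) sequentially"
  shows "degree p \<le> d"
proof (rule ccontr)
  assume "\<not> degree p \<le> d"
  then have deg: "d < degree p" by simp
  define P :: "real poly" where "P = map_poly of_rat p"
  have degP: "degree P = degree p" unfolding P_def by (rule degree_map_poly) simp
  then have lc: "lead_coeff P \<noteq> 0" using deg leading_coeff_0_iff[of P] by (metis degree_0 not_less0)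
  have P: "poly P (of_nat h) = of_rat (poly p (of_nat h))" for h
    using poly_map_of_rat[of p "of_nat h"] by (simp add: P_def)
  have pos: "eventually (\<lambda>h. 0 < poly Q (of_nat h)) sequentially"
    if Q: "lead_coeff Q > 0" for Q :: "real poly"
  proof -
    obtain b where b: "\<And>x. x \<ge> b \<Longrightarrow> poly Q x \<ge> lead_coeff Q"
      using poly_pinfty_gt_lc[OF Q] by blast
    have "0 < poly Q (of_nat h)" if "h \<ge> nat \<lceil>b\<rceil>" for h
    proof -
      have "b \<le> of_nat h" using that by linarith
      from b[OF this] show ?thesis using Q by linarith
    qed
    then show ?thesis unfolding eventually_sequentially by blast
  qed
  show False
  proof (cases "lead_coeff P > 0")
    case True
    define Q where "Q = P - monom (of_rat B) d"
    have "degree Q = degree P" "lead_coeff Q = lead_coeff P"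
    proof -
      have d: "degree (- monom (of_rat B) d :: real poly) < degree P"
        using deg degP degree_monom_le[of "of_rat B :: real" d] by simp
      show "degree Q = degree P" using degree_add_eq_left[OF d] by (simp add: Q_def)
      then show "lead_coeff Q = lead_coeff P" using deg degP by (simp add: Q_def)
    qed
    then have "eventually (\<lambda>h. 0 < poly Q (of_nat h)) sequentially" using True pos by simp
    then have "eventually (\<lambda>h. False) sequentially"
      using bound
    proof eventually_elim
      case (elim h)
      then have "of_rat (B * of_nat h ^ d) < (of_rat (poly p (of_nat h)) :: real)"
        by (simp add: Q_def P poly_monom of_rat_mult of_rat_power)
      then show ?case using elim unfolding of_rat_less by simp
    qed
    then show False by simp
  next
    case False
    then have "lead_coeff P < 0" using lc by linarith
    then have "lead_coeff (- P) > 0" by simp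
    from pos[OF this] bound have "eventually (\<lambda>h. False) sequentially"
    proof eventually_elim
      case (elim h)
      then have "of_rat (poly p (of_nat h)) < (of_rat 0 :: real)" by (simp add: P)
      then show ?case using elim unfolding of_rat_less by simp
    qed
    then show False by simp
  qed
qed

section \<open>Dickson's lemma\<close>

text \<open>
  A decreasing sequence of natural numbers is constant from the place where it attains its
  minimum, so a monotone subsequence of either direction contains a nondecreasing one.
\<close>

lemma nat_mono_subsequence:
  fixes s :: "nat \<Rightarrow> nat"
  obtains r :: "nat \<Rightarrow> nat" where "strict_mono r" "mono (\<lambda>n. s (r n))"
proof -
  obtain f where f: "strict_mono f" "monoseq (\<lambda>n. s (f n))" using seq_monosub by blast
  show thesis
  proof (cases "incseq (\<lambda>n. s (f n))")
    case True
    then show thesis using that f by blast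
  next
    case False
    then have dec: "decseq (\<lambda>n. s (f n))" using f(2) by (simp add: monoseq_iff)
    obtain m where m: "\<forall>n. s (f m) \<le> s (f n)"
      using ex_has_least_nat[of "\<lambda>_. True" 0 "\<lambda>n. s (f n)"] by auto
    have "s (f (n + m)) = s (f m)" for n
      using m decseqD[OF dec, of m "n + m"] by (simp add: le_antisym)
    moreover have "strict_mono (\<lambda>n. f (n + m))" using f(1) by (simp add: strict_mono_def)
    ultimately show thesis using that[of "\<lambda>n. f (n + m)"] by (simp add: mono_def)
  qed
qed

text \<open>
  Dickson's lemma in its strong form, a subsequence that is nondecreasing in all coordinates
  of \<open>A\<close> at once; this form passes through an induction on \<open>A\<close>.
\<close>

lemma dickson_subsequence:
  fixes x :: "nat \<Rightarrow> 'a \<Rightarrow> nat"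
  assumes "finite A"
  shows "\<exists>r :: nat \<Rightarrow> nat. strict_mono r \<and> (\<forall>a\<in>A. mono (\<lambda>n. x (r n) a))"
  using assms
proof (induction A rule: finite_induct)
  case empty
  show ?case by (intro exI[of _ id]) (simp add: strict_mono_def)
next
  case (insert b A)
  then obtain r :: "nat \<Rightarrow> nat" where r: "strict_mono r" "\<forall>a\<in>A. mono (\<lambda>n. x (r n) a)" by blast
  obtain q :: "nat \<Rightarrow> nat" where q: "strict_mono q" "mono (\<lambda>n. x (r (q n)) b)"
    using nat_mono_subsequence[of "\<lambda>n. x (r n) b"] .
  have "strict_mono (\<lambda>n. r (q n))" using r(1) q(1) by (simp add: strict_mono_def)
  moreover have "mono (\<lambda>n. x (r (q n)) a)" if "a \<in> A" for a
    using r(2) that strict_mono_mono[OF q(1)] by (simp add: mono_def)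
  ultimately show ?case using q(2) by blast
qed

text \<open>
  The exponent vectors of a monomial ideal in the variables \<open>A\<close>.  Vectors are extensional
  functions so that each is determined by its values on \<open>A\<close>, as in \<^const>\<open>representations\<close>.
\<close>

definition up_closed :: "'a set \<Rightarrow> ('a \<Rightarrow> nat) set \<Rightarrow> bool" where
  "up_closed A U \<longleftrightarrow> U \<subseteq> A \<rightarrow>\<^sub>E UNIV \<and>
     (\<forall>k\<in>U. \<forall>l\<in>A \<rightarrow>\<^sub>E UNIV. (\<forall>a\<in>A. k a \<le> l a) \<longrightarrow> l \<in> U)"

lemma up_closedD:
  "up_closed A U \<Longrightarrow> k \<in> U \<Longrightarrow> l \<in> A \<rightarrow>\<^sub>E UNIV \<Longrightarrow> (\<And>a. a \<in> A \<Longrightarrow> k a \<le> l a) \<Longrightarrow> l \<in> U"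
  by (auto simp: up_closed_def)

text \<open>
  The ascending chain condition.  If the chain grew forever, then beyond every \<open>V J\<close> there
  would be a vector \<open>x J\<close> outside \<open>V J\<close> in some later member \<open>V (g J)\<close>.  Along a nondecreasing subsequence,
  \<open>x (r 0)\<close> lies below all \<open>x (r i)\<close>; since it belongs to the up-closed \<open>V (g (r 0))\<close>, so do
  they, against the choice of \<open>x (r i)\<close> as soon as \<open>r i \<ge> g (r 0)\<close>.
\<close>

lemma up_closed_chain_stabilises:
  fixes V :: "nat \<Rightarrow> ('a \<Rightarrow> nat) set"
  assumes fin: "finite A" and up: "\<And>j. up_closed A (V j)" and "mono V"
  obtains J where "\<And>j. j \<ge> J \<Longrightarrow> V j = V J"
proof (rule ccontr)
  assume "\<not> thesis"
  then have "\<forall>J. \<exists>j\<ge>J. V j \<noteq> V J" using that by blast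
  have "\<exists>j k. k \<in> V j \<and> k \<notin> V J" for J
  proof -
    obtain j where "j \<ge> J" "V j \<noteq> V J" using \<open>\<forall>J. \<exists>j\<ge>J. V j \<noteq> V J\<close> by blast
    moreover have "V J \<subseteq> V j" using \<open>mono V\<close> \<open>j \<ge> J\<close> by (rule monoD)
    ultimately show ?thesis by blast
  qed
  then obtain g x where x: "\<And>J. x J \<in> V (g J)" "\<And>J. x J \<notin> V J" by metis
  obtain r :: "nat \<Rightarrow> nat" where r: "strict_mono r" "\<forall>a\<in>A. mono (\<lambda>n. x (r n) a)"
    using dickson_subsequence[OF fin] by blast
  define i where "i = g (r 0)"
  have i: "i \<le> r i" using strict_mono_imp_increasing[OF r(1)] .
  have "x (r i) \<in> A \<rightarrow>\<^sub>E UNIV" using x(1) up unfolding up_closed_def by blast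
  moreover have "x (r 0) a \<le> x (r i) a" if "a \<in> A" for a using r(2) that by (simp add: mono_def)
  ultimately have "x (r i) \<in> V i"
    using up_closedD[OF up x(1)[of "r 0"]] by (simp add: i_def)
  then show False using x(2)[of "r i"] monoD[OF \<open>mono V\<close> i] by blast
qed

section \<open>Hilbert functions of up-closed sets\<close>

lemma finite_level:
  assumes "finite A"
  shows "finite {k \<in> A \<rightarrow>\<^sub>E UNIV. sum k A = (h::nat)}"
proof (rule finite_subset)
  show "{k \<in> A \<rightarrow>\<^sub>E UNIV. sum k A = h} \<subseteq> A \<rightarrow>\<^sub>E {..h}"
    using member_le_sum[OF _ _ assms] by (fastforce simp: PiE_iff)
qed (simp add: assms finite_PiE)

text \<open>
  Slice along the new coordinate \<open>b\<close>: with \<open>V j\<close> the slice at value \<open>j\<close>, the level \<open>h\<close> of \<open>U\<close>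
  splits into the levels \<open>h - j\<close> of the \<open>V j\<close>.  Once the slices are constant, say from \<open>J\<close> on,
  the values \<open>j \<ge> J\<close> contribute a partial sum of the Hilbert function of the single set
  \<open>V J\<close>, and the remaining values contribute \<open>J\<close> shifted Hilbert functions.
\<close>

lemma eventually_polynomial_up_closed:
  assumes "finite A" "up_closed A U"
  shows "eventually_polynomial (\<lambda>h. of_nat (card {k \<in> U. sum k A = h}))"
  using assms
proof (induction A arbitrary: U rule: finite_induct)
  case empty
  have "eventually (\<lambda>h. rat_of_nat (card {k \<in> U. sum k {} = h}) = 0) sequentially"
    using eventually_gt_at_top[of 0] by eventually_elim simp
  then show ?case by (rule eventually_polynomial_cong) (rule eventually_polynomial_const)
next
  case (insert b A)
  define V where "V j = {k \<in> A \<rightarrow>\<^sub>E UNIV. k(b := j) \<in> U}" for j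
  define L where "L j h = {k \<in> V j. sum k A = h}" for j h
  have upd: "k(b := j) \<in> insert b A \<rightarrow>\<^sub>E UNIV" if "k \<in> A \<rightarrow>\<^sub>E UNIV" for k j
    using that by (auto simp: PiE_iff extensional_def)
  have up: "up_closed A (V j)" for j
    unfolding up_closed_def V_def
  proof (intro conjI ballI impI)
    fix k l assume k: "k \<in> {k \<in> A \<rightarrow>\<^sub>E UNIV. k(b := j) \<in> U}"
      and l: "l \<in> A \<rightarrow>\<^sub>E UNIV" "\<forall>a\<in>A. k a \<le> l a"
    have "k(b := j) \<in> U" using k by simp
    then have "l(b := j) \<in> U"
      using upd[OF l(1)] by (rule up_closedD[OF insert.prems]) (use l in auto)
    then show "l \<in> {k \<in> A \<rightarrow>\<^sub>E UNIV. k(b := j) \<in> U}" using l by simp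
  qed blast
  have "V j \<subseteq> V j'" if "j \<le> j'" for j j'
  proof
    fix k assume k: "k \<in> V j"
    then have "k(b := j) \<in> U" "k(b := j') \<in> insert b A \<rightarrow>\<^sub>E UNIV" by (simp_all add: V_def upd)
    then have "k(b := j') \<in> U"
      by (rule up_closedD[OF insert.prems]) (use that in simp)
    then show "k \<in> V j'" using k by (simp add: V_def)
  qed
  then have "mono V" by (rule monoI)
  then obtain J where J: "\<And>j. j \<ge> J \<Longrightarrow> V j = V J"
    using up_closed_chain_stabilises[where V = V, OF insert.hyps(1) up] by blast
  have ep: "eventually_polynomial (\<lambda>h. of_nat (card (L j h)))" for j
    unfolding L_def by (rule insert.IH[OF up])
  have slices: "card {k \<in> U. sum k (insert b A) = h} = (\<Sum>j\<le>h. card (L j (h - j)))" for h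
  proof -
    have "bij_betw (\<lambda>(j, k). k(b := j)) (SIGMA j:{..h}. L j (h - j)) {k \<in> U. sum k (insert b A) = h}"
    proof (rule bij_betw_byWitness[where f' = "\<lambda>k. (k b, restrict k A)"])
      have s: "sum (k(b := j)) A = sum k A" for k :: "_ \<Rightarrow> nat" and j
        using insert.hyps by (auto intro!: sum.cong)
      show "\<forall>x\<in>(SIGMA j:{..h}. L j (h - j)). (\<lambda>k. (k b, restrict k A)) ((\<lambda>(j, k). k(b := j)) x) = x"
        using insert.hyps(2)
        by (auto simp: L_def V_def PiE_iff extensional_def restrict_def fun_eq_iff)
      have glue: "(restrict k A)(b := k b) = k" if "k \<in> U" for k
        using that insert.prems
        by (force simp: up_closed_def PiE_iff extensional_def restrict_def fun_eq_iff)
      then show "\<forall>k\<in>{k \<in> U. sum k (insert b A) = h}. (\<lambda>(j, k). k(b := j)) (k b, restrict k A) = k"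
        by simp
      show "(\<lambda>(j, k). k(b := j)) ` (SIGMA j:{..h}. L j (h - j)) \<subseteq> {k \<in> U. sum k (insert b A) = h}"
        using insert.hyps s by (auto simp: L_def V_def)
      show "(\<lambda>k. (k b, restrict k A)) ` {k \<in> U. sum k (insert b A) = h} \<subseteq> (SIGMA j:{..h}. L j (h - j))"
        using insert.hyps glue by (auto simp: L_def V_def)
    qed
    then have "card {k \<in> U. sum k (insert b A) = h} = card (SIGMA j:{..h}. L j (h - j))"
      by (simp add: bij_betw_same_card)
    also have "\<dots> = (\<Sum>j\<le>h. card (L j (h - j)))"
    proof (rule card_SigmaI)
      show "\<forall>j\<in>{..h}. finite (L j (h - j))"
      proof
        fix j show "finite (L j (h - j))"
          by (rule finite_subset[OF _ finite_level[OF insert.hyps(1), of "h - j"]])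
            (auto simp: L_def V_def)
      qed
    qed simp
    finally show ?thesis .
  qed
  have split: "(\<Sum>j\<le>h. card (L j (h - j))) = (\<Sum>j<J. card (L j (h - j))) + (\<Sum>i\<le>h - J. card (L J i))"
    if "h \<ge> J" for h
  proof -
    have "{..h} = {..<J} \<union> {J..h}" using that by auto
    moreover have "{..<J} \<inter> {J..h} = {}" by auto
    ultimately have "(\<Sum>j\<le>h. card (L j (h - j))) = (\<Sum>j<J. card (L j (h - j))) + (\<Sum>j=J..h. card (L j (h - j)))"
      using sum.union_disjoint[of "{..<J}" "{J..h}" "\<lambda>j. card (L j (h - j))"] by simp
    also have "(\<Sum>j=J..h. card (L j (h - j))) = (\<Sum>j=J..h. card (L J (h - j)))"
    proof (rule sum.cong)
      fix j assume "j \<in> {J..h}"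
      then have "V j = V J" by (intro J) simp
      then show "card (L j (h - j)) = card (L J (h - j))" by (simp add: L_def)
    qed simp
    also have "\<dots> = (\<Sum>i\<le>h - J. card (L J i))"
      by (rule sum.reindex_bij_witness[of _ "\<lambda>i. h - i" "\<lambda>j. h - j"]) (use that in auto)
    finally show ?thesis .
  qed
  have "eventually (\<lambda>h. rat_of_nat (card {k \<in> U. sum k (insert b A) = h})
      = (\<Sum>j<J. of_nat (card (L j (h - j)))) + (\<Sum>i\<le>h - J. of_nat (card (L J i)))) sequentially"
    using eventually_ge_at_top[of J]
  proof eventually_elim
    case (elim h)
    have "rat_of_nat (card {k \<in> U. sum k (insert b A) = h})
        = rat_of_nat ((\<Sum>j<J. card (L j (h - j))) + (\<Sum>i\<le>h - J. card (L J i)))"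
      unfolding slices split[OF elim] ..
    then show ?case by simp
  qed
  moreover have "eventually_polynomial
      (\<lambda>h. (\<Sum>j<J. of_nat (card (L j (h - j)))) + (\<Sum>i\<le>h - J. of_nat (card (L J i))))"
    by (intro eventually_polynomial_add eventually_polynomial_sum eventually_polynomial_shift
        eventually_polynomial_shift[OF eventually_polynomial_partial_sums] ep)
  ultimately show ?case by (rule eventually_polynomial_cong)
qed

section \<open>Ranks within the fibres\<close>

text \<open>
  The order on \<open>\<nat>\<^sup>A\<close> is obtained from the usual order on \<open>\<nat>\<close> by encoding \<open>k\<close> as the
  product of the prime powers \<open>\<nu> a ^ k a\<close> for distinct primes \<open>\<nu> a\<close>.  Unique factorisation makes
  the code injective; translation becomes multiplication by a positive number and therefore
  preserves the order.  That \<open>l'\<close> and \<open>k'\<close> arise from \<open>l\<close> and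
  \<open>k\<close> by the same translation is the equation \<open>l' - l = k' - k\<close>, written additively because
  subtraction truncates.
\<close>

lemma translation_invariant_code:
  assumes "finite A"
  obtains N :: "('a \<Rightarrow> nat) \<Rightarrow> nat" where
    "inj_on N (A \<rightarrow>\<^sub>E UNIV)"
    "\<And>k l k' l'. N l < N k \<Longrightarrow> (\<And>a. a \<in> A \<Longrightarrow> l' a + k a = l a + k' a) \<Longrightarrow> N l' < N k'"
proof -
  obtain P where P: "P \<subseteq> {p::nat. prime p}" "finite P" "card P = card A"
    using infinite_arbitrarily_large[OF primes_infinite] by blast
  then obtain \<nu> where \<nu>: "bij_betw \<nu> A P"
    using finite_same_card_bij[OF assms P(2)] by metis
  then have prime: "prime (\<nu> a)" if "a \<in> A" for a using P(1) that bij_betwE by blast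
  have inj: "inj_on \<nu> A" using \<nu> by (simp add: bij_betw_def)
  define N where "N k = (\<Prod>a\<in>A. \<nu> a ^ k a)" for k
  have pos: "N k > 0" for k
    unfolding N_def by (intro prod_pos) (simp add: prime prime_gt_0_nat)
  have mult: "multiplicity (\<nu> a) (N k) = k a" if "a \<in> A" for a k
  proof -
    define f where "f = (\<lambda>p. k (inv_into A \<nu> p))"
    have "N k = (\<Prod>p\<in>P. p ^ f p)"
      unfolding N_def prod.reindex_bij_betw[OF \<nu>, of "\<lambda>p. p ^ f p", symmetric]
      by (rule prod.cong) (simp_all add: f_def inj)
    then have "multiplicity (\<nu> a) (N k) = f (\<nu> a)"
      using multiplicity_prod_prime_powers[OF P(2), of "\<nu> a" f] P(1) prime[OF that]
        bij_betwE[OF \<nu>] that by auto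
    then show ?thesis using that inj by (simp add: f_def)
  qed
  show thesis
  proof
    show "inj_on N (A \<rightarrow>\<^sub>E UNIV)"
      by (rule inj_onI) (metis mult PiE_ext)
  next
    fix k l k' l'
    assume less: "N l < N k" and shift: "\<And>a. a \<in> A \<Longrightarrow> l' a + k a = l a + k' a"
    have "N l' * N k = N l * N k'"
      unfolding N_def prod.distrib[symmetric] power_add[symmetric] by (simp add: shift)
    also have "\<dots> < N k * N k'" using less pos by simp
    finally show "N l' < N k'" by (simp add: mult.commute)
  qed
qed

text \<open>
  Ranks are distinct and smaller than \<open>card F\<close>; there are \<open>card F\<close> of them, so all values occur.
\<close>

lemma bij_betw_rank:
  fixes N :: "'a \<Rightarrow> nat"
  assumes "finite F" "inj_on N F"
  shows "bij_betw (\<lambda>k. card {l \<in> F. N l < N k}) F {..<card F}"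
proof -
  let ?r = "\<lambda>k. card {l \<in> F. N l < N k}"
  have less: "?r k < ?r l" if "k \<in> F" "N k < N l" for k l
    by (rule psubset_card_mono) (use assms that in auto)
  have inj: "inj_on ?r F"
  proof (rule inj_onI)
    fix k l assume kl: "k \<in> F" "l \<in> F" "?r k = ?r l"
    then have "N k = N l"
      using less[of k l] less[of l k] by (cases "N k" "N l" rule: linorder_cases) auto
    then show "k = l" using assms(2) kl by (simp add: inj_onD)
  qed
  have "?r k < card F" if "k \<in> F" for k
    by (rule psubset_card_mono) (use assms that in auto)
  then have "?r ` F = {..<card F}"
    by (intro card_subset_eq) (auto simp: card_image[OF inj])
  with inj show ?thesis by (simp add: bij_betw_def)
qed

lemma finite_representations: "finite A \<Longrightarrow> finite (representations A h p)"
  by (rule finite_subset[OF _ finite_level[of A h]]) (auto simp: representations_def)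

text \<open>
  The map \<open>val\<close> is a bijection from the vectors of rank \<open>s\<close> and coordinate sum \<open>h\<close> to the points
  with more than \<open>s\<close> representations, and these vectors are the difference of two levels of
  up-closed sets.
\<close>

lemma eventually_polynomial_rep_sumset:
  fixes A :: "(int ^ 'd::finite) set"
  assumes "finite A"
  shows "eventually_polynomial (\<lambda>h. of_nat (card (rep_sumset h A (Suc s))))"
proof -
  obtain N :: "(int ^ 'd \<Rightarrow> nat) \<Rightarrow> nat" where inj: "inj_on N (A \<rightarrow>\<^sub>E UNIV)"
    and shift: "\<And>k l k' l'. N l < N k \<Longrightarrow> (\<And>a. a \<in> A \<Longrightarrow> l' a + k a = l a + k' a) \<Longrightarrow> N l' < N k'"
    using translation_invariant_code[OF assms] by blast
  define val where "val k = (\<Sum>a\<in>A. int (k a) *s a)" for k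
  define fib where "fib k = representations A (sum k A) (val k)" for k
  define rank where "rank k = card {l \<in> fib k. N l < N k}" for k
  define U where "U s = {k \<in> A \<rightarrow>\<^sub>E UNIV. rank k \<ge> s}" for s
  have fib_iff: "l \<in> fib k \<longleftrightarrow> l \<in> A \<rightarrow>\<^sub>E UNIV \<and> val l = val k \<and> sum l A = sum k A" for k l
    by (auto simp: fib_def representations_def val_def)
  have rank_mono: "rank k \<le> rank k'" if le: "\<And>a. a \<in> A \<Longrightarrow> k a \<le> k' a" for k k'
  proof -
    \<comment> \<open>translation by \<open>k' - k\<close>, which is nonnegative on \<open>A\<close>\<close>
    define T where "T l = restrict (\<lambda>a. l a + (k' a - k a)) A" for l
    have T: "T l a + k a = l a + k' a" if "a \<in> A" for l a using that le[OF that] by (simp add: T_def)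
    have T_inj: "inj_on T (A \<rightarrow>\<^sub>E UNIV)"
    proof (rule inj_onI)
      fix l m assume "l \<in> A \<rightarrow>\<^sub>E UNIV" "m \<in> A \<rightarrow>\<^sub>E UNIV" "T l = T m"
      then show "l = m" using T by (metis PiE_ext add_right_cancel)
    qed
    have val_T: "val (T l) + val k = val l + val k'" for l
    proof -
      have "int (T l a) *s a + int (k a) *s a = int (l a) *s a + int (k' a) *s a" if "a \<in> A" for a
        unfolding vector_sadd_rdistrib[symmetric] of_nat_add[symmetric] T[OF that] ..
      then show ?thesis unfolding val_def sum.distrib[symmetric] by (rule sum.cong[OF refl])
    qed
    have sum_T: "sum (T l) A + sum k A = sum l A + sum k' A" for l
      unfolding sum.distrib[symmetric] by (rule sum.cong) (simp_all add: T)
    have "T l \<in> {l \<in> fib k'. N l < N k'}" if l: "l \<in> fib k" "N l < N k" for l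
    proof -
      have "val (T l) = val k'" using val_T[of l] l(1) by (simp add: fib_iff add.commute)
      moreover have "sum (T l) A = sum k' A" using sum_T[of l] l(1) by (simp add: fib_iff)
      moreover have "T l \<in> A \<rightarrow>\<^sub>E UNIV" by (simp add: T_def)
      ultimately show ?thesis using shift[OF l(2), of "T l" k'] T by (simp add: fib_iff)
    qed
    then have "T ` {l \<in> fib k. N l < N k} \<subseteq> {l \<in> fib k'. N l < N k'}" by blast
    moreover have "finite {l \<in> fib k'. N l < N k'}"
      by (simp add: fib_def finite_representations assms)
    moreover have "inj_on T {l \<in> fib k. N l < N k}"
      by (rule inj_on_subset[OF T_inj]) (auto simp: fib_iff)
    ultimately show ?thesis unfolding rank_def by (intro card_inj_on_le)
  qed
  have up: "up_closed A (U s)" for s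
    unfolding up_closed_def U_def by (auto intro: order_trans[OF _ rank_mono])
  let ?H = "\<lambda>s h. card {k \<in> U s. sum k A = h}"
  have count: "rat_of_nat (card (rep_sumset h A (Suc s))) = of_nat (?H s h) - of_nat (?H (Suc s) h)" for h
  proof -
    let ?R = "{k \<in> A \<rightarrow>\<^sub>E UNIV. rank k = s \<and> sum k A = h}"
    have fin: "finite {k \<in> U s. sum k A = h}" for s
      by (rule finite_subset[OF _ finite_level[OF assms, of h]]) (auto simp: U_def)
    have rank_bij: "bij_betw rank (representations A h p) {..<rep_count A h p}" for p
    proof -
      have fib: "fib k = representations A h p" if "k \<in> representations A h p" for k
        using that by (auto simp: fib_def representations_def val_def)
      have "bij_betw (\<lambda>k. card {l \<in> representations A h p. N l < N k})
          (representations A h p) {..<rep_count A h p}"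
        unfolding rep_count_def
        by (intro bij_betw_rank finite_representations assms inj_on_subset[OF inj])
          (auto simp: representations_def)
      then show ?thesis
        by (rule bij_betw_cong[THEN iffD1, rotated]) (simp add: rank_def fib)
    qed
    have "bij_betw val ?R (rep_sumset h A (Suc s))"
      unfolding bij_betw_def
    proof
      show "inj_on val ?R"
      proof (rule inj_onI)
        fix k l assume kl: "k \<in> ?R" "l \<in> ?R" "val k = val l"
        then have "k \<in> representations A h (val l)" "l \<in> representations A h (val l)"
          by (auto simp: representations_def val_def)
        then show "k = l"
          using rank_bij[of "val l"] kl unfolding bij_betw_def inj_on_def by auto
      qed
      show "val ` ?R = rep_sumset h A (Suc s)"
      proof (intro equalityI subsetI)
        fix p assume "p \<in> val ` ?R"
        then obtain k where k: "k \<in> representations A h p" "rank k = s"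
          by (auto simp: representations_def val_def)
        then have "s < rep_count A h p" using bij_betwE[OF rank_bij] by auto
        then show "p \<in> rep_sumset h A (Suc s)" by (simp add: rep_sumset_def)
      next
        fix p assume "p \<in> rep_sumset h A (Suc s)"
        then have "s \<in> rank ` representations A h p"
          using rank_bij[of p] by (simp add: rep_sumset_def bij_betw_def)
        then show "p \<in> val ` ?R" by (auto simp: representations_def val_def image_iff)
      qed
    qed
    moreover have "?R = {k \<in> U s. sum k A = h} - {k \<in> U (Suc s). sum k A = h}"
      by (auto simp: U_def)
    moreover have "{k \<in> U (Suc s). sum k A = h} \<subseteq> {k \<in> U s. sum k A = h}"
      by (auto simp: U_def)
    ultimately show ?thesis
      using fin by (simp add: bij_betw_same_card[symmetric] card_Diff_subset of_nat_diff card_mono)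
  qed
  show ?thesis unfolding count
    by (intro eventually_polynomial_diff eventually_polynomial_up_closed assms up)
qed

section \<open>Polynomial growth\<close>

lemma card_cube_le:
  assumes "finite S"
  shows "finite {v :: 'a ^ 'd::finite. \<forall>i. v $ i \<in> S}"
    and "card {v :: 'a ^ 'd::finite. \<forall>i. v $ i \<in> S} \<le> card S ^ CARD('d)"
proof -
  have cube: "{v :: 'a ^ 'd. \<forall>i. v $ i \<in> S} \<subseteq> vec_lambda ` (UNIV \<rightarrow>\<^sub>E S)"
  proof
    fix v :: "'a ^ 'd" assume "v \<in> {v. \<forall>i. v $ i \<in> S}"
    then have "(\<lambda>i. v $ i) \<in> UNIV \<rightarrow>\<^sub>E S" "v = vec_lambda (\<lambda>i. v $ i)" by auto
    then show "v \<in> vec_lambda ` (UNIV \<rightarrow>\<^sub>E S)" by blast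
  qed
  have fin: "finite ((UNIV :: 'd set) \<rightarrow>\<^sub>E S)" using assms by (simp add: finite_PiE)
  show "finite {v :: 'a ^ 'd. \<forall>i. v $ i \<in> S}" using cube fin finite_surj by blast
  have "card {v :: 'a ^ 'd. \<forall>i. v $ i \<in> S} \<le> card ((UNIV :: 'd set) \<rightarrow>\<^sub>E S)"
    using cube fin by (rule surj_card_le[rotated])
  then show "card {v :: 'a ^ 'd. \<forall>i. v $ i \<in> S} \<le> card S ^ CARD('d)" by (simp add: card_PiE)
qed

text \<open>
  A sum of \<open>h\<close> elements of \<open>A\<close> has coordinates of absolute value at most \<open>C h\<close>, where \<open>C\<close>
  bounds the coordinates of the elements of \<open>A\<close>.  As \<open>t \<ge> 1\<close>, every point counted is
  such a sum.  For \<open>h \<ge> 1\<close> the number \<open>2 C h + 1\<close> of values of a coordinate is at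
  most \<open>(2 C + 1) h\<close>.
\<close>

lemma card_rep_sumset_le:
  fixes A :: "(int ^ 'd::finite) set"
  assumes "finite A" "t \<ge> 1"
  obtains B :: nat where "\<And>h. h \<ge> 1 \<Longrightarrow> card (rep_sumset h A t) \<le> B * h ^ CARD('d)"
proof -
  define C where "C = (\<Sum>a\<in>A. \<Sum>i\<in>UNIV. nat \<bar>a $ i\<bar>)"
  have C: "\<bar>a $ i\<bar> \<le> int C" if "a \<in> A" for a i
  proof -
    have "nat \<bar>a $ i\<bar> \<le> (\<Sum>i\<in>UNIV. nat \<bar>a $ i\<bar>)" by (rule member_le_sum) auto
    also have "\<dots> \<le> C" unfolding C_def by (rule member_le_sum) (use assms that in auto)
    finally show ?thesis by simp
  qed
  have "card (rep_sumset h A t) \<le> (2 * C + 1) ^ CARD('d) * h ^ CARD('d)" if "h \<ge> 1" for h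
  proof -
    let ?S = "{- int (C * h)..int (C * h)}"
    have "p $ i \<in> ?S" if "p \<in> rep_sumset h A t" for p i
    proof -
      have "representations A h p \<noteq> {}"
        using that assms(2) by (auto simp: rep_sumset_def rep_count_def)
      then obtain k where k: "(\<Sum>a\<in>A. int (k a) *s a) = p" "sum k A = h"
        by (auto simp: representations_def)
      have "\<bar>p $ i\<bar> = \<bar>\<Sum>a\<in>A. int (k a) * a $ i\<bar>" by (simp add: k(1)[symmetric])
      also have "\<dots> \<le> (\<Sum>a\<in>A. int (k a) * int C)"
        by (rule order_trans[OF sum_abs]) (auto intro!: sum_mono mult_left_mono simp: abs_mult C)
      also have "\<dots> = int (C * h)" by (simp add: k(2)[symmetric] sum_distrib_left mult.commute)
      finally show ?thesis by auto
    qed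
    then have "card (rep_sumset h A t) \<le> card {v :: int ^ 'd. \<forall>i. v $ i \<in> ?S}"
      by (intro card_mono card_cube_le) auto
    also have "\<dots> \<le> card ?S ^ CARD('d)" by (rule card_cube_le) simp
    also have "\<dots> \<le> ((2 * C + 1) * h) ^ CARD('d)"
      by (rule power_mono) (use that in \<open>auto simp: algebra_simps nat_add_distrib nat_mult_distrib\<close>)
    finally show ?thesis unfolding power_mult_distrib .
  qed
  then show thesis by (rule that)
qed

theorem theorem1p5:
  fixes A :: "(int ^ 'd::finite) set" and t :: nat
  assumes "finite A" and "t \<ge> 1"
  shows "\<exists>(hKh :: nat) (p :: rat poly). degree p \<le> CARD('d) \<and>
           (\<forall>h\<ge>hKh. of_nat (card (rep_sumset h A t)) = poly p (of_nat h))"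
proof -
  obtain s where t: "t = Suc s" using assms(2) by (cases t) auto
  obtain p :: "rat poly" where
    p: "eventually (\<lambda>h. of_nat (card (rep_sumset h A t)) = poly p (of_nat h)) sequentially"
    using eventually_polynomial_rep_sumset[OF assms(1), of s]
    unfolding eventually_polynomial_def t by blast
  obtain B where B: "\<And>h. h \<ge> 1 \<Longrightarrow> card (rep_sumset h A t) \<le> B * h ^ CARD('d)"
    using card_rep_sumset_le[OF assms] by blast
  have "eventually (\<lambda>h. 0 \<le> poly p (of_nat h) \<and>
      poly p (of_nat h) \<le> of_nat B * of_nat h ^ CARD('d)) sequentially"
    using p eventually_ge_at_top[of 1]
  proof eventually_elim
    case (elim h)
    have "rat_of_nat (card (rep_sumset h A t)) \<le> of_nat (B * h ^ CARD('d))"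
      using B[OF elim(2)] unfolding of_nat_le_iff .
    then show ?case using elim(1)[symmetric] by simp
  qed
  then have "degree p \<le> CARD('d)" by (rule degree_le_if_poly_bounded)
  then show ?thesis using p unfolding eventually_sequentially by blast
qed

end
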